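(* For every $n\ge 1$ there exists a finitely generated, torsion-free subgroup $\Gamma<\mathcal{G}^0(n)$ that cannot be realized by homeomorphisms, i.e. there is no homomorphism $\phi:\Gamma\to\mathrm{Homeo}(\mathbb{R}^n,0)$ such that for every $\gamma\in\Gamma$ the germ of $\phi(\gamma)$ at $0$ equals $\gamma$. Moreover, $\Gamma$ can be chosen to consist of germs of $C^\infty$ diffeomorphisms (i.e. inside $\mathcal{G}^\infty(n)$).
   Context: $\mathrm{Homeo}(\mathbb{R}^n,0)$ (resp. $\mathrm{Diff}^r(\mathbb{R}^n,0)$) denotes the group of orientation-preserving homeomorphisms (resp. $C^r$ diffeomorphisms) of $\mathbb{R}^n$ fixing the origin. $\mathcal{G}^r(n)$ denotes the group of germs at $0$ of elements of $\mathrm{Diff}^r(\mathbb{R}^n,0)$, i.e. the quotient of $\mathrm{Diff}^r(\mathbb{R}^n,0)$ by the normal subgroup of elements that restrict to the identity on some neighborhood of $0$; $\mathcal{G}^0(n)$ is the case of homeomorphisms. *)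

theory Defs
  imports "HOL-Analysis.Analysis" "HOL-Algebra.Algebra"
begin

definition homeo0 :: "(real^'n \<Rightarrow> real^'n) set" where
  "homeo0 = {f. bij f \<and> continuous_on UNIV f \<and> continuous_on UNIV (Hilbert_Choice.inv f) \<and> f 0 = 0}"

definition Homeo_grp :: "(real^'n \<Rightarrow> real^'n) monoid" where
  "Homeo_grp = \<lparr>carrier = homeo0, mult = (\<circ>), one = id\<rparr>"

definition germ :: "(real^'n \<Rightarrow> real^'n) \<Rightarrow> (real^'n \<Rightarrow> real^'n) set" where
  "germ f = {g. \<exists>e>0. \<forall>x\<in>ball 0 e. g x = f x}"

definition germ_mult ::
  "(real^'n \<Rightarrow> real^'n) set \<Rightarrow> (real^'n \<Rightarrow> real^'n) set \<Rightarrow> (real^'n \<Rightarrow> real^'n) set" where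
  "germ_mult A B = germ ((SOME f. f \<in> A \<inter> homeo0) \<circ> (SOME g. g \<in> B \<inter> homeo0))"

definition G0 :: "(real^'n \<Rightarrow> real^'n) set monoid" where
  "G0 = \<lparr>carrier = germ ` homeo0, mult = germ_mult, one = germ id\<rparr>"

fun iter_pderiv :: "'n list \<Rightarrow> (real^'n \<Rightarrow> real) \<Rightarrow> real^'n \<Rightarrow> real" where
  "iter_pderiv [] g = g"
| "iter_pderiv (i # is) g = (\<lambda>x. deriv (\<lambda>t. iter_pderiv is g (x + t *\<^sub>R axis i 1)) 0)"

definition smooth_map :: "(real^'n::finite \<Rightarrow> real^'n) \<Rightarrow> bool" where
  "smooth_map f \<longleftrightarrow>
     (\<forall>k is. continuous_on UNIV (iter_pderiv is (\<lambda>y. f y $ k))) \<and>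
     (\<forall>k is i x. ((\<lambda>t. iter_pderiv is (\<lambda>y. f y $ k) (x + t *\<^sub>R axis i 1))
                    has_real_derivative iter_pderiv (i # is) (\<lambda>y. f y $ k) x) (at 0))"

definition diff_inf0 :: "(real^'n::finite \<Rightarrow> real^'n) set" where
  "diff_inf0 = {f. bij f \<and> smooth_map f \<and> smooth_map (Hilbert_Choice.inv f) \<and> f 0 = 0
                 \<and> det (jacobian f (at 0)) > 0}"

end

theory Submission
  imports Defs
begin

text \<open>
  Let \<open>t\<close> halve every coordinate and let \<open>s\<close> act on every coordinate by a diffeomorphism of the line
  that is infinitely tangent to the identity at 0 and moves exactly the points of the shells
  \<open>(1 / l\<^sub>j, 2 / l\<^sub>j)\<close>, where \<open>l\<^sub>j = 3 ^ j * 2 ^ j\<^sup>2\<close>. The shells get so sparse that, for each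
  \<open>k > 0\<close>, the maps \<open>s\<close> and \<open>t\<^sup>k s t\<^sup>-\<^sup>k\<close> have disjoint supports near 0, hence their germs commute.
  In a realization, \<open>s\<close> and \<open>t\<close> are given by these formulas on a ball that does not depend on \<open>k\<close>.
  For \<open>k = 2 * j + 2\<close> the conjugation by \<open>t\<^sup>k\<close> carries the \<open>j\<close>-th shell to an interval overlapping
  the next shell without coinciding with it, so for large \<open>j\<close> the realized maps do not commute.
  The group generated by \<open>s\<close> and \<open>t\<close> is torsion-free because it acts coordinatewise by increasing maps.
\<close>

subsection \<open>Smooth functions on the line\<close>

text \<open>\<open>deriv\<close> is a total operator, so the existence of each derivative is
  demanded separately.\<close>

primrec times_differentiable :: "nat \<Rightarrow> (real \<Rightarrow> real) \<Rightarrow> bool" where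
  "times_differentiable 0 f \<longleftrightarrow> True"
| "times_differentiable (Suc n) f \<longleftrightarrow>
     (\<forall>x. (f has_real_derivative deriv f x) (at x)) \<and> times_differentiable n (deriv f)"

text \<open>Uniqueness of derivatives replaces \<open>deriv f\<close> by an explicit formula. The
  closure lemmas below name the derivative and show that it stays in the class.\<close>

lemma times_differentiable_SucI:
  assumes "\<And>x. (f has_real_derivative f' x) (at x)" "times_differentiable n f'"
  shows "times_differentiable (Suc n) f"
proof -
  have "deriv f = f'"
    using assms(1) by (auto intro: DERIV_imp_deriv)
  with assms show ?thesis by simp
qed

lemma times_differentiable_SucD: "times_differentiable (Suc n) f \<Longrightarrow> times_differentiable n f"
  by (induction n arbitrary: f) auto

lemma times_differentiable_const: "times_differentiable n (\<lambda>x. c)"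
proof (induction n arbitrary: c)
  case (Suc n)
  show ?case
    by (rule times_differentiable_SucI[where f' = "\<lambda>x. 0"]) (auto intro: Suc)
qed simp

lemma times_differentiable_ident: "times_differentiable n (\<lambda>x. x)"
proof (cases n)
  case (Suc n)
  then show ?thesis
    using times_differentiable_SucI[of "\<lambda>x. x" "\<lambda>x. 1" n] times_differentiable_const
    by auto
qed simp

lemma times_differentiable_add:
  "times_differentiable n f \<Longrightarrow> times_differentiable n g \<Longrightarrow> times_differentiable n (\<lambda>x. f x + g x)"
proof (induction n arbitrary: f g)
  case (Suc n)
  show ?case
    by (rule times_differentiable_SucI[where f' = "\<lambda>x. deriv f x + deriv g x"])
       (use Suc in \<open>auto intro!: DERIV_add\<close>)
qed simp

lemma times_differentiable_mult:
  "times_differentiable n f \<Longrightarrow> times_differentiable n g \<Longrightarrow> times_differentiable n (\<lambda>x. f x * g x)"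
proof (induction n arbitrary: f g)
  case (Suc n)
  have "times_differentiable n f" "times_differentiable n g"
    using Suc.prems times_differentiable_SucD by blast+
  show ?case
    by (rule times_differentiable_SucI[where f' = "\<lambda>x. deriv f x * g x + deriv g x * f x"])
       (use Suc \<open>times_differentiable n f\<close> \<open>times_differentiable n g\<close> in
         \<open>auto intro!: DERIV_mult times_differentiable_add\<close>)
qed simp

lemma times_differentiable_compose:
  "times_differentiable n f \<Longrightarrow> times_differentiable n g \<Longrightarrow> times_differentiable n (\<lambda>x. f (g x))"
proof (induction n arbitrary: f g)
  case (Suc n)
  have g: "times_differentiable n g"
    using Suc.prems times_differentiable_SucD by blast
  show ?case
    by (rule times_differentiable_SucI[where f' = "\<lambda>x. deriv f (g x) * deriv g x"])
       (use Suc g in \<open>auto intro!: times_differentiable_mult DERIV_chain2[of f _ g]\<close>)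
qed simp

text \<open>The derivative of \<open>1 / f\<close> is a product of a constant, \<open>f'\<close> and
  two copies of \<open>1 / f\<close>, so the induction hypothesis and closure under products
  suffice.\<close>

lemma times_differentiable_inverse:
  "times_differentiable n f \<Longrightarrow> (\<And>x. f x \<noteq> 0) \<Longrightarrow> times_differentiable n (\<lambda>x. inverse (f x))"
proof (induction n arbitrary: f)
  case (Suc n)
  have f: "times_differentiable n f"
    using Suc.prems times_differentiable_SucD by blast
  have "times_differentiable n (\<lambda>x. inverse (f x))"
    using Suc f by blast
  then show ?case
    by (intro times_differentiable_SucI[where f' = "\<lambda>x. (- 1) * ((inverse (f x) * deriv f x) * inverse (f x))"]
          times_differentiable_mult times_differentiable_const)
       (use Suc in \<open>auto intro!: derivative_eq_intros\<close>)
qed simp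

definition smooth_fun :: "(real \<Rightarrow> real) \<Rightarrow> bool" where
  "smooth_fun f \<longleftrightarrow> (\<forall>n. times_differentiable n f)"

lemma smooth_fun_has_deriv: "smooth_fun f \<Longrightarrow> (f has_real_derivative deriv f x) (at x)"
  unfolding smooth_fun_def by (metis times_differentiable.simps(2))

lemma smooth_fun_deriv: "smooth_fun f \<Longrightarrow> smooth_fun (deriv f)"
  unfolding smooth_fun_def by (metis times_differentiable.simps(2))

lemma smooth_fun_isCont: "smooth_fun f \<Longrightarrow> isCont f x"
  using smooth_fun_has_deriv DERIV_isCont by blast

lemma smooth_fun_funpow_deriv: "smooth_fun f \<Longrightarrow> smooth_fun ((deriv ^^ m) f)"
  by (induction m) (auto intro: smooth_fun_deriv)

subsection \<open>A bump function\<close>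

text \<open>The usual flat function is the case \<open>k = 0\<close>. With the factors
  \<open>inverse x ^ k\<close> included, each derivative is a linear combination of members of the
  family.\<close>

definition flat_fun :: "nat \<Rightarrow> real \<Rightarrow> real" where
  "flat_fun k x = (if x > 0 then inverse x ^ k * exp (- inverse x) else 0)"

text \<open>With \<open>y = 1 / x\<close>, the term of index \<open>k + 2\<close> of the exponential
  series is at most \<open>exp y\<close>. The quadratic bound is what makes the difference quotient
  at 0 vanish.\<close>

lemma flat_fun_le:
  assumes "x > 0"
  shows "flat_fun k x \<le> fact (k + 2) * x\<^sup>2"
proof -
  define y where "y = inverse x"
  have "y > 0" using assms by (simp add: y_def)
  have "y ^ (k + 2) /\<^sub>R fact (k + 2) \<le> exp y"
    unfolding exp_def
    using sum_le_suminf[OF summable_exp_generic[of y], of "{k + 2}"] \<open>y > 0\<close> by auto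
  then have "y ^ (k + 2) \<le> fact (k + 2) * exp y"
    by (simp add: field_simps del: fact_Suc add_2_eq_Suc')
  then have "y ^ k * y\<^sup>2 * exp (- y) \<le> fact (k + 2)"
    by (simp add: power_add exp_minus field_simps del: fact_Suc add_2_eq_Suc')
  moreover have "y ^ k * exp (- y) = (y ^ k * y\<^sup>2 * exp (- y)) * x\<^sup>2"
    using assms by (simp add: y_def field_simps)
  ultimately show ?thesis
    using assms unfolding flat_fun_def y_def[symmetric]
    by (metis mult_right_mono zero_le_power2)
qed

lemma flat_fun_has_deriv:
  "(flat_fun k has_real_derivative flat_fun (k + 2) x + - real k * flat_fun (k + 1) x) (at x)"
proof -
  consider "x > 0" | "x < 0" | "x = 0" by linarith
  then show ?thesis
  proof cases
    case 1
    have "((\<lambda>x. inverse x ^ k * exp (- inverse x)) has_real_derivative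
             flat_fun (k + 2) x + - real k * flat_fun (k + 1) x) (at x)"
      using 1 unfolding flat_fun_def
      apply (auto intro!: derivative_eq_intros)
      \<comment> \<open>The power rule produces the truncated exponent \<open>k - 1\<close>, hence
        the split.\<close>
      apply (cases k)
       apply (auto simp: field_simps power2_eq_square)
      done
    then show ?thesis
      by (rule has_field_derivative_transform_within_open[where S = "{0<..}"])
         (use 1 in \<open>auto simp: flat_fun_def\<close>)
  next
    case 2
    have "((\<lambda>x. 0) has_real_derivative 0) (at x)" by simp
    then have "(flat_fun k has_real_derivative 0) (at x)"
      by (rule has_field_derivative_transform_within_open[where S = "{..<0}"])
         (use 2 in \<open>auto simp: flat_fun_def\<close>)
    then show ?thesis using 2 by (simp add: flat_fun_def)
  next
    case 3
    \<comment> \<open>The quotient is 0 on the left of 0, and on the right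
      \<open>flat_fun_le\<close> bounds it by a multiple of \<open>h\<close>.\<close>
    have "((\<lambda>h. flat_fun k h / h) \<longlongrightarrow> 0) (at 0)"
    proof (rule Lim_null_comparison)
      show "\<forall>\<^sub>F h in at 0. norm (flat_fun k h / h) \<le> fact (k + 2) * \<bar>h\<bar>"
      proof (intro always_eventually allI)
        fix h :: real
        show "norm (flat_fun k h / h) \<le> fact (k + 2) * \<bar>h\<bar>"
        proof (cases "h > 0")
          case True
          then have "0 \<le> flat_fun k h" by (simp add: flat_fun_def)
          with True flat_fun_le[OF True, of k] show ?thesis
            by (simp add: field_simps power2_eq_square del: fact_Suc add_2_eq_Suc')
        next
          case False
          then have "flat_fun k h = 0" by (simp add: flat_fun_def)
          then show ?thesis by (metis abs_ge_zero div_0 fact_ge_zero norm_zero mult_nonneg_nonneg)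
        qed
      qed
      show "((\<lambda>h::real. fact (k + 2) * \<bar>h\<bar>) \<longlongrightarrow> 0) (at 0)"
        by (auto intro!: tendsto_eq_intros)
    qed
    then have "(flat_fun k has_real_derivative 0) (at 0)"
      by (simp add: DERIV_def flat_fun_def)
    then show ?thesis using 3 by (simp add: flat_fun_def)
  qed
qed

lemma times_differentiable_flat_fun: "times_differentiable n (flat_fun k)"
proof (induction n arbitrary: k)
  case (Suc n)
  show ?case
    by (rule times_differentiable_SucI[OF flat_fun_has_deriv])
       (intro times_differentiable_add times_differentiable_mult times_differentiable_const Suc)
qed simp

text \<open>The arguments are written with sums and products only, so that the closure lemmas apply
  to them as they stand.\<close>

definition bump :: "real \<Rightarrow> real" where
  "bump x = flat_fun 0 (x + - 1) * flat_fun 0 (2 + (- 1) * x)"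

lemma smooth_fun_bump: "smooth_fun bump"
proof -
  have "times_differentiable n bump" for n
    unfolding bump_def[abs_def]
    by (intro times_differentiable_mult times_differentiable_compose[OF times_differentiable_flat_fun]
        times_differentiable_add times_differentiable_const times_differentiable_ident)
  then show ?thesis by (simp add: smooth_fun_def)
qed

lemma bump_pos: "1 < x \<Longrightarrow> x < 2 \<Longrightarrow> 0 < bump x"
  by (simp add: bump_def flat_fun_def)

lemma bump_eq_0: "x \<le> 1 \<or> 2 \<le> x \<Longrightarrow> bump x = 0"
  by (auto simp: bump_def flat_fun_def)

lemma bump_nonneg: "0 \<le> bump x"
  by (simp add: bump_def flat_fun_def)

section \<open>Bounded derivatives and series of dilated copies\<close>

lemma deriv_eq_0_outside:
  fixes f :: "real \<Rightarrow> real"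
  assumes "\<And>x. x \<notin> {a..b} \<Longrightarrow> f x = 0" "x \<notin> {a..b}"
  shows "deriv f x = 0"
proof -
  have "((\<lambda>x. 0) has_real_derivative 0) (at x)" by simp
  then have "(f has_real_derivative 0) (at x)"
    by (rule has_field_derivative_transform_within_open[where S = "- {a..b}"])
       (use assms in \<open>auto intro: open_Compl\<close>)
  then show ?thesis by (rule DERIV_imp_deriv)
qed

text \<open>All derivatives vanish off the compact interval and are continuous on it.\<close>

lemma smooth_fun_deriv_bounded:
  assumes "smooth_fun f" "\<And>x. x \<notin> {a..b} \<Longrightarrow> f x = 0"
  shows "\<exists>B. \<forall>x. \<bar>(deriv ^^ m) f x\<bar> \<le> B"
proof -
  have zero: "(deriv ^^ m) f x = 0" if "x \<notin> {a..b}" for x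
    using that
  proof (induction m arbitrary: x)
    case 0
    then show ?case using assms(2) by simp
  next
    case (Suc m)
    then show ?case using deriv_eq_0_outside[of a b "(deriv ^^ m) f"] by simp
  qed
  have "continuous_on {a..b} ((deriv ^^ m) f)"
    by (intro continuous_at_imp_continuous_on ballI smooth_fun_isCont smooth_fun_funpow_deriv assms)
  then have "bounded ((deriv ^^ m) f ` {a..b})"
    by (intro compact_imp_bounded compact_continuous_image) auto
  then obtain B where B: "\<And>x. x \<in> {a..b} \<Longrightarrow> \<bar>(deriv ^^ m) f x\<bar> \<le> B"
    unfolding bounded_iff by (metis imageI real_norm_def)
  have "\<bar>(deriv ^^ m) f x\<bar> \<le> max B 0" for x
    using B[of x] zero[of x] by (cases "x \<in> {a..b}") auto
  then show ?thesis by blast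
qed

text \<open>The Weierstrass M-test applies to the series, with majorant
  \<open>B * \<bar>c j\<bar>\<close>, and to its termwise derivative, with majorant
  \<open>B' * \<bar>c j * l j\<bar>\<close>. Uniform convergence of the latter permits termwise
  differentiation.\<close>

lemma dilated_series:
  assumes f: "\<And>x. (f has_real_derivative deriv f x) (at x)"
    and B: "\<And>x. \<bar>f x\<bar> \<le> B" and B': "\<And>x. \<bar>deriv f x\<bar> \<le> B'"
    and c: "summable (\<lambda>j. \<bar>c j\<bar>)" and cl: "summable (\<lambda>j. \<bar>c j * l j\<bar>)"
  shows "summable (\<lambda>j. c j * f (l j * x))"
    and "((\<lambda>x. suminf (\<lambda>j. c j * f (l j * x))) has_real_derivative (suminf (\<lambda>j. c j * l j * deriv f (l j * x)))) (at x)"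
proof -
  show sm: "summable (\<lambda>j. c j * f (l j * x))" for x
    by (rule summable_comparison_test'[OF summable_mult[OF c, of B]])
       (use mult_left_mono[OF B abs_ge_zero] in \<open>simp add: abs_mult mult.commute\<close>)
  show "((\<lambda>x. suminf (\<lambda>j. c j * f (l j * x))) has_real_derivative (suminf (\<lambda>j. c j * l j * deriv f (l j * x)))) (at x)"
  proof (rule has_field_derivative_series'(2)[of UNIV _ _ 0])
    show "((\<lambda>x. c j * f (l j * x)) has_real_derivative c j * l j * deriv f (l j * x)) (at x within UNIV)" for j x
      by (auto intro!: derivative_eq_intros DERIV_chain2[OF f])
    show "uniformly_convergent_on UNIV (\<lambda>n x. \<Sum>j<n. c j * l j * deriv f (l j * x))"
      by (rule Weierstrass_m_test'[OF _ summable_mult[OF cl, of B']])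
         (use mult_right_mono[OF B', of "\<bar>c n * l n\<bar>" for n] in \<open>simp add: abs_mult mult_ac\<close>)
    show "summable (\<lambda>j. c j * f (l j * 0))" by (rule sm)
  qed auto
qed

text \<open>The derivative is a series of the same shape, with \<open>deriv f\<close> for
  \<open>f\<close> and \<open>c j * l j\<close> for \<open>c j\<close>. The induction therefore
  generalizes over both, and summability is assumed against every power of
  \<open>l j\<close>.\<close>

lemma times_differentiable_dilated_series:
  assumes "smooth_fun f" "\<And>m. \<exists>B. \<forall>x. \<bar>(deriv ^^ m) f x\<bar> \<le> B"
    and "\<And>m. summable (\<lambda>j. \<bar>c j * l j ^ m\<bar>)"
  shows "times_differentiable n (\<lambda>x. suminf (\<lambda>j. c j * f (l j * x)))"
  using assms
proof (induction n arbitrary: f c)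
  case (Suc n)
  obtain B B' where B: "\<And>x. \<bar>f x\<bar> \<le> B" "\<And>x. \<bar>deriv f x\<bar> \<le> B'"
    using Suc.prems(2)[of 0] Suc.prems(2)[of 1] by auto
  show ?case
  proof (rule times_differentiable_SucI)
    show "((\<lambda>x. suminf (\<lambda>j. c j * f (l j * x))) has_real_derivative (suminf (\<lambda>j. c j * l j * deriv f (l j * x)))) (at x)" for x
      using Suc.prems(3)[of 0] Suc.prems(3)[of 1] B
      by (intro dilated_series smooth_fun_has_deriv Suc.prems) auto
    show "times_differentiable n (\<lambda>x. suminf (\<lambda>j. c j * l j * deriv f (l j * x)))"
    proof (rule Suc.IH)
      show "\<exists>B. \<forall>x. \<bar>(deriv ^^ m) (deriv f) x\<bar> \<le> B" for m
        using Suc.prems(2)[of "Suc m"] by (simp add: funpow_swap1)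
      show "summable (\<lambda>j. \<bar>c j * l j * l j ^ m\<bar>)" for m
        using Suc.prems(3)[of "Suc m"] by (simp add: mult.assoc)
    qed (use Suc.prems smooth_fun_deriv in auto)
  qed
qed simp

subsection \<open>Smooth diffeomorphisms of the line\<close>

text \<open>The positive derivative makes inverses smooth and later gives the Jacobian of the
  coordinatewise map a positive determinant.\<close>

definition line_diffeos :: "(real \<Rightarrow> real) set" where
  "line_diffeos = {h. smooth_fun h \<and> bij h \<and> h 0 = 0 \<and> (\<forall>x. deriv h x > 0)}"

lemma line_diffeos_strict_mono:
  assumes "h \<in> line_diffeos" "x < y"
  shows "h x < h y"
  using assms DERIV_pos_imp_increasing[of x y h] smooth_fun_has_deriv[of h]
  unfolding line_diffeos_def by blast

lemma line_diffeos_eq_iff: "h \<in> line_diffeos \<Longrightarrow> h x = h y \<longleftrightarrow> x = y"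
  by (auto simp: line_diffeos_def bij_def inj_eq)

lemma line_diffeos_small:
  assumes "h \<in> line_diffeos" "\<epsilon> > 0"
  shows "\<exists>\<delta>>0. \<forall>x. \<bar>x\<bar> < \<delta> \<longrightarrow> \<bar>h x\<bar> < \<epsilon>"
proof -
  have "isCont h 0" "h 0 = 0"
    using assms smooth_fun_isCont by (auto simp: line_diffeos_def)
  then show ?thesis
    using assms(2) by (auto simp: continuous_at_eps_delta dist_real_def)
qed

lemma line_diffeos_comp:
  assumes "f \<in> line_diffeos" "g \<in> line_diffeos"
  shows "f \<circ> g \<in> line_diffeos"
proof -
  have "((f \<circ> g) has_real_derivative deriv f (g x) * deriv g x) (at x)" for x
    unfolding o_def using assms
    by (intro DERIV_chain2) (auto simp: line_diffeos_def intro: smooth_fun_has_deriv)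
  then have "deriv (f \<circ> g) x = deriv f (g x) * deriv g x" for x
    by (rule DERIV_imp_deriv)
  with assms show ?thesis
    by (auto simp: line_diffeos_def smooth_fun_def o_def bij_comp[unfolded o_def]
        intro: times_differentiable_compose)
qed

lemma line_diffeos_inverse:
  assumes h: "h \<in> line_diffeos"
  defines "g \<equiv> Hilbert_Choice.inv h"
  shows "g \<in> line_diffeos"
proof -
  have bij: "bij h" and sm: "smooth_fun h" and pos: "\<And>x. deriv h x > 0"
    using h by (auto simp: line_diffeos_def)
  have hg: "h (g x) = x" for x
    unfolding g_def using bij by (simp add: bij_is_surj surj_f_inv_f)
  have gh: "g (h x) = x" for x
    unfolding g_def using bij by (simp add: bij_is_inj)
  have cont: "isCont g x" for x
  proof -
    have "isCont g (h (g x))"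
      by (rule isCont_inverse_function[where d = 1]) (auto simp: gh smooth_fun_isCont[OF sm])
    then show ?thesis by (simp add: hg)
  qed
  have der: "(g has_real_derivative inverse (deriv h (g x))) (at x)" for x
    by (rule DERIV_inverse_function[where f = h and a = "x - 1" and b = "x + 1"])
       (use pos[of "g x"] in \<open>auto simp: hg cont intro: smooth_fun_has_deriv[OF sm]\<close>)
  \<comment> \<open>Bootstrapping: \<open>g' = 1 / (h' \<circ> g)\<close> expresses the derivative
    through \<open>g\<close> itself, so each order of differentiability of \<open>g\<close> yields
    the next.\<close>
  have "times_differentiable n g" for n
  proof (induction n)
    case (Suc n)
    have "times_differentiable n (\<lambda>x. inverse (deriv h (g x)))"
      using smooth_fun_deriv[OF sm] Suc pos
      by (intro times_differentiable_inverse times_differentiable_compose[of n "deriv h" g])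
         (auto simp: smooth_fun_def less_imp_neq[symmetric])
    then show ?case using der by (rule times_differentiable_SucI[rotated])
  qed simp
  moreover have "deriv g x = inverse (deriv h (g x))" for x
    using der by (rule DERIV_imp_deriv)
  moreover have "g 0 = 0"
    using gh[of 0] h by (simp add: line_diffeos_def)
  ultimately show ?thesis
    using pos bij by (auto simp: line_diffeos_def smooth_fun_def g_def bij_imp_bij_inv)
qed

lemma line_diffeos_mult:
  assumes "a > 0"
  shows "(\<lambda>x. a * x) \<in> line_diffeos"
proof -
  have "((\<lambda>x. a * x) has_real_derivative a) (at x)" for x
    by (auto intro!: derivative_eq_intros)
  then have "deriv (\<lambda>x. a * x) x = a" for x
    by (rule DERIV_imp_deriv)
  moreover have "bij (\<lambda>x. a * x)"
    by (rule bij_betw_byWitness[where f' = "\<lambda>x. x / a"]) (use assms in auto)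
  ultimately show ?thesis
    using assms by (auto simp: line_diffeos_def smooth_fun_def
        intro!: times_differentiable_mult times_differentiable_const times_differentiable_ident)
qed

lemma line_diffeos_funpow:
  assumes "h \<in> line_diffeos"
  shows "h ^^ m \<in> line_diffeos"
proof (induction m)
  case 0
  show ?case using line_diffeos_mult[of 1] by (simp add: id_def)
next
  case (Suc m)
  then show ?case using assms line_diffeos_comp by (simp only: funpow.simps)
qed

text \<open>A point moved by an increasing map keeps moving in the same direction and never returns.
  This is the source of torsion-freeness.\<close>

lemma line_diffeos_funpow_fixed:
  assumes h: "h \<in> line_diffeos" and "m > 0" "(h ^^ m) x = x"
  shows "h x = x"
proof (rule ccontr)
  assume "h x \<noteq> x"
  then consider "h x > x" | "h x < x" by linarith
  then show False
  proof cases
    case 1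
    have "(h ^^ Suc m) x > x" for m
      by (induction m) (use 1 line_diffeos_strict_mono[OF h] in \<open>auto intro: less_trans[OF 1]\<close>)
    then show False using assms by (metis gr0_implies_Suc less_irrefl)
  next
    case 2
    have "(h ^^ Suc m) x < x" for m
      by (induction m) (use 2 line_diffeos_strict_mono[OF h] in \<open>auto intro: less_trans[OF _ 2]\<close>)
    then show False using assms by (metis gr0_implies_Suc less_irrefl)
  qed
qed

subsection \<open>A diffeomorphism supported on sparse shells\<close>

text \<open>The ratio of consecutive scales is \<open>3 / 2\<close> times a power of 2. A power of
  the dilation undoes the latter, and the factor \<open>3 / 2\<close> remains as a partial overlap
  of two shells. The ratios are unbounded, so the gaps outgrow any fixed dilation.\<close>

definition shell_scale :: "nat \<Rightarrow> real" where
  "shell_scale j = 3 ^ j * 2 ^ j\<^sup>2"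

lemma shell_scale_Suc: "shell_scale (Suc j) = 3 / 2 * 2 ^ (2 * j + 2) * shell_scale j"
proof -
  have "(Suc j)\<^sup>2 = j\<^sup>2 + (2 * j + 1)"
    by (simp add: power2_eq_square)
  then show ?thesis
    by (simp add: shell_scale_def power_add)
qed

lemma shell_scale_pos: "0 < shell_scale j"
  by (simp add: shell_scale_def)

lemma shell_scale_ge: "2 ^ j \<le> shell_scale j"
proof -
  have "(2::real) ^ j * 1 \<le> 3 ^ j * 2 ^ j\<^sup>2"
    by (intro mult_mono power_mono) auto
  then show ?thesis by (simp add: shell_scale_def)
qed

lemma shell_scale_ge_1: "1 \<le> shell_scale j"
  using shell_scale_ge[of j] one_le_power[of "2::real" j] by linarith

lemma six_power_ge_1: "1 \<le> 6 * (2::real) ^ j"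
  using one_le_power[of "2::real" j] by linarith

text \<open>The ratio of the scales of index \<open>j + 1\<close> and \<open>j\<close> is
  \<open>6 * 4 ^ j\<close>, which is at least \<open>6 * 2 ^ j\<close>. Since all ratios exceed 1,
  this carries over to arbitrary \<open>i < j\<close>.\<close>

lemma shell_scale_gap:
  assumes "i < j"
  shows "6 * 2 ^ i * shell_scale i \<le> shell_scale j"
  using assms
proof (induction j)
  case (Suc j)
  have "2 ^ j \<le> (2::real) ^ (2 * j)" by (rule power_increasing) auto
  then have step: "6 * 2 ^ j * shell_scale j \<le> shell_scale (Suc j)"
    using shell_scale_pos[of j] by (simp add: shell_scale_Suc)
  show ?case
  proof (cases "i = j")
    case False
    then have "6 * 2 ^ i * shell_scale i \<le> shell_scale j" using Suc by simp
    also have "\<dots> \<le> 6 * 2 ^ j * shell_scale j"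
      using shell_scale_pos[of j] six_power_ge_1[of j] by simp
    finally show ?thesis using step by simp
  qed (use step in simp)
qed simp

text \<open>One term of the exponential series bounds \<open>exp (- y) * y ^ m\<close> by
  \<open>fact (m + 1) / y\<close>, and \<open>y \<ge> 2 ^ j\<close> leaves a geometric
  majorant.\<close>

lemma shell_coeff_summable: "summable (\<lambda>j. \<bar>exp (- shell_scale j) * shell_scale j ^ m\<bar>)"
proof (rule summable_comparison_test')
  show "summable (\<lambda>j. fact (m + 1) * (1 / 2 :: real) ^ j)"
    by (intro summable_mult summable_geometric) auto
  fix j :: nat
  define y where "y = shell_scale j"
  have y: "y > 0" "2 ^ j \<le> y"
    using shell_scale_pos shell_scale_ge by (auto simp: y_def)
  have "y ^ (m + 1) /\<^sub>R fact (m + 1) \<le> exp y"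
    unfolding exp_def
    using sum_le_suminf[OF summable_exp_generic[of y], of "{m + 1}"] y by auto
  then have "exp (- y) * y ^ m * y \<le> fact (m + 1)"
    by (simp add: exp_minus field_simps del: fact_Suc)
  then have "exp (- y) * y ^ m \<le> fact (m + 1) / y"
    using y by (simp add: field_simps del: fact_Suc)
  also have "\<dots> \<le> fact (m + 1) / 2 ^ j"
    using y by (intro divide_left_mono) auto
  finally show "norm \<bar>exp (- shell_scale j) * shell_scale j ^ m\<bar> \<le> fact (m + 1) * (1 / 2) ^ j"
    using y by (simp add: y_def power_divide del: fact_Suc)
qed

text \<open>The weights \<open>exp (- shell_scale j)\<close> beat every power of the scale, so the
  bumps sum to a smooth function although they accumulate at 0.\<close>

definition shell_bumps :: "real \<Rightarrow> real" where
  "shell_bumps x = suminf (\<lambda>j. exp (- shell_scale j) * bump (shell_scale j * x))"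

lemma bump_deriv_bounded: "\<exists>B. \<forall>x. \<bar>(deriv ^^ m) bump x\<bar> \<le> B"
  by (rule smooth_fun_deriv_bounded[of _ 1 2]) (auto simp: smooth_fun_bump intro: bump_eq_0)

lemma smooth_fun_shell_bumps: "smooth_fun shell_bumps"
  unfolding smooth_fun_def shell_bumps_def[abs_def]
  by (intro allI times_differentiable_dilated_series smooth_fun_bump bump_deriv_bounded
      shell_coeff_summable)

lemma shell_bumps_summable: "summable (\<lambda>j. exp (- shell_scale j) * bump (shell_scale j * x))"
proof -
  obtain B B' where "\<And>x. \<bar>bump x\<bar> \<le> B" "\<And>x. \<bar>deriv bump x\<bar> \<le> B'"
    using bump_deriv_bounded[of 0] bump_deriv_bounded[of 1] by auto
  then show ?thesis
    using shell_coeff_summable[of 0] shell_coeff_summable[of 1]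
    by (intro dilated_series(1) smooth_fun_has_deriv smooth_fun_bump) auto
qed

definition shells :: "real set" where
  "shells = {x. \<exists>j. 1 < shell_scale j * x \<and> shell_scale j * x < 2}"

lemma shell_bumps_pos_iff: "0 < shell_bumps x \<longleftrightarrow> x \<in> shells"
proof -
  have "0 < shell_bumps x \<longleftrightarrow> (\<exists>j. 0 < exp (- shell_scale j) * bump (shell_scale j * x))"
    unfolding shell_bumps_def
    by (rule suminf_pos_iff[OF shell_bumps_summable]) (simp add: bump_nonneg)
  also have "\<dots> \<longleftrightarrow> x \<in> shells"
    using bump_pos bump_eq_0 unfolding shells_def
    by (auto simp: zero_less_mult_iff) (metis less_irrefl not_less)+
  finally show ?thesis .
qed

lemma shell_bumps_nonneg: "0 \<le> shell_bumps x"
  unfolding shell_bumps_def by (intro suminf_nonneg shell_bumps_summable) (simp add: bump_nonneg)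

lemma shell_bumps_eq_0: "x \<notin> shells \<Longrightarrow> shell_bumps x = 0"
  using shell_bumps_nonneg[of x] shell_bumps_pos_iff[of x] by linarith

lemma shells_subset: "shells \<subseteq> {0..2}"
proof
  fix x assume "x \<in> shells"
  then obtain j where j: "1 < shell_scale j * x" "shell_scale j * x < 2"
    by (auto simp: shells_def)
  then have "x > 0" using shell_scale_pos[of j] by (metis less_trans zero_less_mult_pos zero_less_one)
  moreover have "1 * x \<le> shell_scale j * x"
    using shell_scale_ge_1[of j] \<open>x > 0\<close> by (intro mult_right_mono) auto
  ultimately show "x \<in> {0..2}" using j unfolding atLeastAtMost_iff by linarith
qed

text \<open>Lying in two shells allows their scales to differ by a factor of at most 2, whereas
  distinct scales differ by at least 6. The shells are closed here so that end points are
  covered.\<close>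

lemma shells_disjoint:
  assumes "1 \<le> shell_scale i * x" "shell_scale i * x \<le> 2"
    and "1 \<le> shell_scale j * x" "shell_scale j * x \<le> 2"
  shows "i = j"
proof -
  have x: "x > 0"
    using assms(1) shell_scale_pos[of i] by (metis less_le_trans zero_less_mult_pos zero_less_one)
  have *: False if "k < l" "1 \<le> shell_scale k * x" "shell_scale l * x \<le> 2" for k l
  proof -
    have "6 * 1 * shell_scale k \<le> 6 * 2 ^ k * shell_scale k"
      using shell_scale_pos[of k] by (intro mult_right_mono mult_left_mono) auto
    then have "6 * shell_scale k * x \<le> shell_scale l * x"
      using shell_scale_gap[OF that(1)] x by (intro mult_right_mono) auto
    then show False using that by simp
  qed
  show ?thesis using *[of i j] *[of j i] assms by (meson linorder_neqE_nat)
qed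

lemma shell_boundary:
  assumes "shell_scale j * x = 1 \<or> shell_scale j * x = 2"
  shows "x \<notin> shells"
proof
  assume "x \<in> shells"
  then obtain i where i: "1 < shell_scale i * x" "shell_scale i * x < 2"
    by (auto simp: shells_def)
  with assms shells_disjoint[of i x j] show False by auto
qed

text \<open>The gaps between consecutive shells outgrow every fixed dilation factor.\<close>

lemma shells_dilation_disjoint:
  assumes "k > 0"
  shows "\<exists>\<delta>>0. \<forall>x. \<bar>x\<bar> < \<delta> \<longrightarrow> \<not> (x \<in> shells \<and> 2 ^ k * x \<in> shells)"
proof (intro exI[of _ "1 / (2 ^ k * shell_scale k)"] conjI allI impI notI)
  show "0 < 1 / (2 ^ k * shell_scale k)" using shell_scale_pos by simp
  fix x assume x: "\<bar>x\<bar> < 1 / (2 ^ k * shell_scale k)" and "x \<in> shells \<and> 2 ^ k * x \<in> shells"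
  then obtain i j where i: "1 < shell_scale i * x" "shell_scale i * x < 2"
    and j: "1 < shell_scale j * (2 ^ k * x)" "shell_scale j * (2 ^ k * x) < 2"
    unfolding shells_def by blast
  have x0: "x > 0"
    using i(1) shell_scale_pos[of i] by (metis less_trans zero_less_mult_pos zero_less_one)
  have two: "(2::real) \<le> 2 ^ k"
    using assms power_increasing[of 1 k "2::real"] by simp
  consider "i < j" | "i = j" | "j < i" by linarith
  then show False
  proof cases
    case 1
    \<comment> \<open>Here \<open>shell_scale j * x\<close> already exceeds 1, so the dilation by at
      least 2 pushes it beyond 2.\<close>
    have "1 * shell_scale i * x \<le> 6 * 2 ^ i * shell_scale i * x"
      using x0 shell_scale_pos[of i] six_power_ge_1[of i]
      by (intro mult_right_mono) auto
    also have "\<dots> \<le> shell_scale j * x"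
      using shell_scale_gap[OF 1] x0 by (intro mult_right_mono) auto
    finally have "1 < shell_scale j * x" using i by simp
    moreover have "2 * (shell_scale j * x) \<le> 2 ^ k * (shell_scale j * x)"
      using two x0 shell_scale_pos[of j] by (intro mult_right_mono) auto
    ultimately show False using j by (simp add: algebra_simps)
  next
    case 2
    have "2 * (shell_scale j * x) \<le> 2 ^ k * (shell_scale j * x)"
      using two x0 shell_scale_pos[of j] by (intro mult_right_mono) auto
    then show False using i j 2 by (simp add: algebra_simps)
  next
    case 3
    \<comment> \<open>The chosen radius enters here: it keeps \<open>2 ^ k * x\<close> below all
      shells of index up to \<open>k\<close>.\<close>
    have "k \<le> j"
    proof (rule ccontr)
      assume "\<not> k \<le> j"
      then have "shell_scale j \<le> shell_scale k"
        by (auto simp: shell_scale_def intro!: mult_mono power_increasing power_mono)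
      then have "shell_scale j * (2 ^ k * x) \<le> shell_scale k * (2 ^ k * x)"
        using x0 by (intro mult_right_mono) auto
      moreover have "shell_scale k * (2 ^ k * x) < 1"
        using x x0 shell_scale_pos[of k] by (simp add: field_simps)
      ultimately show False using j by linarith
    qed
    \<comment> \<open>The gap factor \<open>6 * 2 ^ j\<close> absorbs the dilation
      \<open>2 ^ k\<close>, so \<open>shell_scale i * x\<close> would exceed 6.\<close>
    have "6 * (2 ^ k * shell_scale j * x) \<le> 6 * (2 ^ j * shell_scale j * x)"
      using x0 shell_scale_pos[of j] power_increasing[OF \<open>k \<le> j\<close>, of "2::real"]
      by (intro mult_left_mono mult_right_mono) auto
    also have "\<dots> \<le> shell_scale i * x"
      using shell_scale_gap[OF 3] x0 mult_right_mono[of "6 * 2 ^ j * shell_scale j" _ x] by simp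
    finally show False using i j by (simp add: algebra_simps)
  qed
qed

text \<open>A small multiple of \<open>shell_bumps\<close> is added to the identity. The small
  factor keeps the derivative positive, and the sign of the bumps makes every moved point move to
  the right.\<close>

lemma sparse_diffeo_exists:
  "\<exists>s\<in>line_diffeos. \<forall>x. x \<le> s x \<and> (s x \<noteq> x \<longleftrightarrow> x \<in> shells)"
proof -
  have out: "shell_bumps x = 0" if "x \<notin> {0..2}" for x
    using that shells_subset by (intro shell_bumps_eq_0) blast
  have bounded: "\<exists>B. \<forall>x. \<bar>(deriv ^^ m) shell_bumps x\<bar> \<le> B" for m
    by (rule smooth_fun_deriv_bounded[OF smooth_fun_shell_bumps out])
  obtain B where B: "\<And>x. \<bar>shell_bumps x\<bar> \<le> B"
    using bounded[of 0] by auto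
  obtain B' where B': "\<And>x. \<bar>deriv shell_bumps x\<bar> \<le> B'"
    using bounded[of 1] by auto
  have "B' \<ge> 0" using B'[of 0] by linarith
  define \<epsilon> where "\<epsilon> = 1 / (B' + 1)"
  have \<epsilon>: "\<epsilon> > 0" "\<epsilon> * B' < 1" using \<open>B' \<ge> 0\<close> by (auto simp: \<epsilon>_def)
  define s where "s x = x + \<epsilon> * shell_bumps x" for x
  have der: "(s has_real_derivative 1 + \<epsilon> * deriv shell_bumps x) (at x)" for x
    unfolding s_def using smooth_fun_has_deriv[OF smooth_fun_shell_bumps]
    by (intro DERIV_add DERIV_ident DERIV_cmult) auto
  have "0 < 1 + \<epsilon> * deriv shell_bumps x" for x
  proof -
    have "\<epsilon> * (- deriv shell_bumps x) \<le> \<epsilon> * B'"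
      using B'[of x] \<epsilon> by (intro mult_left_mono) auto
    with \<epsilon> show ?thesis by simp
  qed
  then have pos: "deriv s x > 0" for x
    using DERIV_imp_deriv[OF der] by simp
  have cont: "isCont s x" for x
    using der DERIV_isCont by blast
  have "inj s"
  proof (rule injI)
    fix x y assume "s x = s y"
    moreover have "s a < s b" if "a < b" for a b
      using that DERIV_pos_imp_increasing[of a b s] der pos DERIV_imp_deriv[OF der] by metis
    ultimately show "x = y" by (metis less_irrefl linorder_neqE_linordered_idom)
  qed
  moreover have "surj s"
  proof (rule surjI)
    fix y
    \<comment> \<open>The displacement lies between 0 and \<open>\<epsilon> * B\<close>, so
      \<open>y - \<epsilon> * B\<close> and \<open>y\<close> bracket a preimage of
      \<open>y\<close>.\<close>
    have "\<epsilon> * shell_bumps x \<le> \<epsilon> * B" for x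
      using B[of x] \<epsilon> by (intro mult_left_mono) auto
    then have "s (y - \<epsilon> * B) \<le> y" by (simp add: s_def)
    moreover have "y \<le> s y" using \<epsilon> shell_bumps_nonneg[of y] by (simp add: s_def)
    moreover have "0 \<le> B" using B[of 0] by linarith
    ultimately have "\<exists>x. s x = y"
      using IVT[of s "y - \<epsilon> * B" y y] cont \<epsilon> by auto
    then show "s (SOME x. s x = y) = y" by (rule someI_ex)
  qed
  moreover have "smooth_fun s"
    using smooth_fun_shell_bumps unfolding s_def[abs_def] smooth_fun_def
    by (auto intro!: times_differentiable_add times_differentiable_mult times_differentiable_const
        times_differentiable_ident)
  moreover have "0 \<notin> shells" by (simp add: shells_def)
  then have "s 0 = 0" by (simp add: s_def shell_bumps_eq_0)
  ultimately have "s \<in> line_diffeos"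
    using pos by (simp add: line_diffeos_def bij_def)
  moreover have "x \<le> s x \<and> (s x \<noteq> x \<longleftrightarrow> x \<in> shells)" for x
    using shell_bumps_nonneg[of x] shell_bumps_pos_iff[of x] \<epsilon> by (auto simp: s_def)
  ultimately show ?thesis by blast
qed

section \<open>Conjugates of the sparse diffeomorphism by dilations\<close>

locale sparse_diffeo =
  fixes s :: "real \<Rightarrow> real"
  assumes diffeo: "s \<in> line_diffeos"
    and moves_right: "x \<le> s x"
    and moved_iff: "s x \<noteq> x \<longleftrightarrow> x \<in> shells"
begin

text \<open>With \<open>t\<close> the halving map, this is the conjugate of \<open>s\<close> by
  \<open>t ^ k\<close>; its moved points are the shells shrunk by \<open>2 ^ k\<close>.\<close>

definition rescaled :: "nat \<Rightarrow> real \<Rightarrow> real" where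
  "rescaled k x = s (2 ^ k * x) / 2 ^ k"

lemma rescaled_diffeo: "rescaled k \<in> line_diffeos"
proof -
  have "(\<lambda>x. (1 / 2 ^ k) * x) \<circ> (s \<circ> (\<lambda>x. 2 ^ k * x)) \<in> line_diffeos"
    by (intro line_diffeos_comp line_diffeos_mult diffeo) auto
  moreover have "(\<lambda>x. (1 / 2 ^ k) * x) \<circ> (s \<circ> (\<lambda>x. 2 ^ k * x)) = rescaled k"
    by (auto simp: rescaled_def)
  ultimately show ?thesis by simp
qed

lemma rescaled_moved_iff: "rescaled k x \<noteq> x \<longleftrightarrow> 2 ^ k * x \<in> shells"
  using moved_iff[of "2 ^ k * x"] by (auto simp: rescaled_def field_simps)

text \<open>An injective map sends moved points to moved points. As the supports are disjoint near
  0, each map fixes both the points moved by the other and their images. The radius keeps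
  \<open>x\<close>, \<open>s x\<close> and \<open>rescaled k x\<close> in the range of
  disjointness.\<close>

lemma rescaled_commutes_near_0:
  assumes "k > 0"
  shows "\<exists>\<delta>>0. \<forall>x. \<bar>x\<bar> < \<delta> \<longrightarrow> rescaled k (s x) = s (rescaled k x)"
proof -
  obtain \<delta> where \<delta>: "\<delta> > 0" "\<And>x. \<bar>x\<bar> < \<delta> \<Longrightarrow> x \<notin> shells \<or> 2 ^ k * x \<notin> shells"
    using shells_dilation_disjoint[OF assms] by blast
  obtain \<delta>1 where \<delta>1: "\<delta>1 > 0" "\<And>x. \<bar>x\<bar> < \<delta>1 \<Longrightarrow> \<bar>s x\<bar> < \<delta>"
    using line_diffeos_small[OF diffeo \<open>\<delta> > 0\<close>] by blast
  obtain \<delta>2 where \<delta>2: "\<delta>2 > 0" "\<And>x. \<bar>x\<bar> < \<delta>2 \<Longrightarrow> \<bar>rescaled k x\<bar> < \<delta>"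
    using line_diffeos_small[OF rescaled_diffeo \<open>\<delta> > 0\<close>] by blast
  have "rescaled k (s x) = s (rescaled k x)"
    if x: "\<bar>x\<bar> < \<delta>" "\<bar>s x\<bar> < \<delta>" "\<bar>rescaled k x\<bar> < \<delta>" for x
  proof (cases "x \<in> shells")
    case True
    then have "s (s x) \<noteq> s x"
      using moved_iff line_diffeos_eq_iff[OF diffeo] by blast
    then have "s x \<in> shells" using moved_iff by blast
    with True x \<delta>(2) have "2 ^ k * x \<notin> shells" "2 ^ k * s x \<notin> shells" by blast+
    then have "rescaled k x = x" "rescaled k (s x) = s x"
      using rescaled_moved_iff by blast+
    then show ?thesis by simp
  next
    case False
    then have sx: "s x = x" using moved_iff by blast
    have "rescaled k x \<notin> shells"
    proof (cases "rescaled k x = x")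
      case False
      then have "rescaled k (rescaled k x) \<noteq> rescaled k x"
        using line_diffeos_eq_iff[OF rescaled_diffeo] by blast
      then have "2 ^ k * rescaled k x \<in> shells" using rescaled_moved_iff by blast
      with x \<delta>(2) show ?thesis by blast
    qed (use \<open>x \<notin> shells\<close> in simp)
    then have "s (rescaled k x) = rescaled k x" using moved_iff by blast
    with sx show ?thesis by simp
  qed
  with \<delta> \<delta>1 \<delta>2 show ?thesis
    by (intro exI[of _ "min \<delta> (min \<delta>1 \<delta>2)"]) auto
qed

text \<open>The shell of index \<open>j + 1\<close> overlaps the shell of index \<open>j\<close> shrunk by \<open>2 ^ (2 * j + 2)\<close>:
  the inner end \<open>u\<close> of the latter is fixed by the rescaled map but moved into its interior by \<open>s\<close>.\<close>

lemma rescaled_not_commute: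
  fixes j :: nat
  defines "k \<equiv> 2 * j + 2"
  shows "\<exists>u. 0 < u \<and> s (2 ^ k * u) = 2 ^ k * u \<and> s (2 ^ k * s u) \<noteq> 2 ^ k * s u
     \<and> u \<le> s u \<and> 2 ^ k * u \<le> 2 / shell_scale j \<and> 2 ^ k * s u \<le> 2 / shell_scale j
     \<and> s (2 ^ k * s u) \<le> 2 / shell_scale j"
proof -
  \<comment> \<open>Thus \<open>2 ^ k * u\<close> is the inner end of shell \<open>j\<close>, while
    \<open>u\<close> is the midpoint of shell \<open>j + 1\<close>.\<close>
  define u where "u = 1 / (2 ^ k * shell_scale j)"
  have lj: "shell_scale j > 0" by (rule shell_scale_pos)
  have lS: "shell_scale (Suc j) = 3 / 2 * 2 ^ k * shell_scale j"
    by (simp only: shell_scale_Suc k_def)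
  have "shell_scale (Suc j) * u = 3 / 2"
    using lj by (simp add: lS u_def)
  then have "u \<in> shells" unfolding shells_def by (intro CollectI exI[of _ "Suc j"]) auto
  then have up: "u < s u" using moves_right[of u] moved_iff[of u] by simp
  have ku: "2 ^ k * u = 1 / shell_scale j" using lj by (simp add: u_def)
  then have "2 ^ k * u \<notin> shells"
    using lj by (intro shell_boundary[of j]) auto
  then have fixu: "s (2 ^ k * u) = 2 ^ k * u" using moved_iff by blast
  \<comment> \<open>Fixed end points and monotonicity trap \<open>s u\<close> below the outer end of
    shell \<open>j + 1\<close>, which dilates to \<open>4 / 3 / shell_scale j\<close>, inside shell
    \<open>j\<close>.\<close>
  have end_fixed: "s (2 / shell_scale i) = 2 / shell_scale i" for i
    using shell_boundary[of i "2 / shell_scale i"] moved_iff shell_scale_pos[of i] by auto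
  have "u < 2 / shell_scale (Suc j)"
    using \<open>shell_scale (Suc j) * u = 3 / 2\<close> shell_scale_pos[of "Suc j"] by (simp add: field_simps)
  then have "s u < 2 / shell_scale (Suc j)"
    using line_diffeos_strict_mono[OF diffeo] end_fixed by metis
  then have "2 ^ k * s u < 2 ^ k * (2 / shell_scale (Suc j))"
    by (intro mult_strict_left_mono) auto
  also have "\<dots> = 4 / 3 / shell_scale j"
    using lj by (simp add: lS)
  finally have hi: "2 ^ k * s u < 4 / 3 / shell_scale j" .
  have lo: "1 / shell_scale j < 2 ^ k * s u"
    using up by (simp flip: ku)
  have "2 ^ k * s u \<in> shells"
    unfolding shells_def using lo hi lj
    by (intro CollectI exI[of _ j]) (simp add: field_simps)
  then have moved: "s (2 ^ k * s u) \<noteq> 2 ^ k * s u" using moved_iff by blast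
  have "4 / 3 / shell_scale j < 2 / shell_scale j" using lj by (simp add: field_simps)
  then have hi2: "2 ^ k * s u < 2 / shell_scale j" using hi by simp
  then have "s (2 ^ k * s u) < 2 / shell_scale j"
    using line_diffeos_strict_mono[OF diffeo] end_fixed by metis
  moreover have "0 < u" using lj by (simp add: u_def)
  moreover have "2 ^ k * u \<le> 2 / shell_scale j" using lj by (simp add: ku divide_right_mono)
  \<comment> \<open>The upper bounds keep every point within \<open>2 / shell_scale j\<close> of 0,
    hence in any prescribed ball once \<open>j\<close> is large.\<close>
  ultimately show ?thesis using up fixu moved hi2 by (intro exI[of _ u]) auto
qed

end

subsection \<open>Coordinatewise maps\<close>

text \<open>Acting coordinatewise carries the construction to every dimension; on the diagonal
  vectors \<open>vec y\<close> the map is \<open>h\<close> itself.\<close>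

definition diag_map :: "(real \<Rightarrow> real) \<Rightarrow> real^'n \<Rightarrow> real^'n" where
  "diag_map h x = (\<chi> i. h (x $ i))"

lemma diag_map_comp: "diag_map f \<circ> diag_map g = diag_map (f \<circ> g)"
  by (auto simp: diag_map_def)

lemma diag_map_id: "diag_map (\<lambda>x. x) = id"
  by (auto simp: diag_map_def vec_eq_iff)

lemma diag_map_vec: "diag_map h (vec y) = vec (h y)"
  by (simp add: diag_map_def vec_eq_iff)

lemma diag_map_inverse:
  assumes "bij h"
  shows "bij (diag_map h :: real^'n \<Rightarrow> _)"
    and "Hilbert_Choice.inv (diag_map h :: real^'n \<Rightarrow> _) = diag_map (Hilbert_Choice.inv h)"
proof -
  have 1: "diag_map h (diag_map (Hilbert_Choice.inv h) x) = (x::real^'n)" for x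
    using assms by (simp add: diag_map_def vec_eq_iff bij_is_surj surj_f_inv_f)
  have 2: "diag_map (Hilbert_Choice.inv h) (diag_map h x) = (x::real^'n)" for x
    using assms by (simp add: diag_map_def vec_eq_iff bij_is_inj)
  show "bij (diag_map h :: real^'n \<Rightarrow> _)"
    by (rule bij_betw_byWitness[where f' = "diag_map (Hilbert_Choice.inv h)"]) (auto simp: 1 2)
  show "Hilbert_Choice.inv (diag_map h :: real^'n \<Rightarrow> _) = diag_map (Hilbert_Choice.inv h)"
    by (rule inv_equality) (auto simp: 1 2)
qed

text \<open>A function of coordinate \<open>k\<close> alone is annihilated by a partial derivative
  in any other direction, so an iterated one survives only if all its indices equal
  \<open>k\<close>.\<close>

lemma iter_pderiv_coordinate:
  assumes "smooth_fun h"
  shows "iter_pderiv is (\<lambda>y::real^'n. h (y $ k)) =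
     (\<lambda>x. if set is \<subseteq> {k} then (deriv ^^ length is) h (x $ k) else 0)"
    and "((\<lambda>t. iter_pderiv is (\<lambda>y::real^'n. h (y $ k)) (x + t *\<^sub>R axis i 1)) has_real_derivative
       (if set (i # is) \<subseteq> {k} then (deriv ^^ length (i # is)) h (x $ k) else 0)) (at 0)"
proof -
  \<comment> \<open>The closed form is differentiated first; this is the induction step for the
    formula and, once the formula is known, the second claim.\<close>
  have *: "((\<lambda>t. if set is \<subseteq> {k} then (deriv ^^ length is) h ((x + t *\<^sub>R axis i 1) $ k) else 0) has_real_derivative
       (if set (i # is) \<subseteq> {k} then (deriv ^^ length (i # is)) h (x $ k) else 0)) (at 0)"
    for "is" i and x :: "real^'n"
  proof (cases "set is \<subseteq> {k} \<and> i = k")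
    case True
    have "((\<lambda>t. x $ k + t) has_real_derivative 1) (at 0)"
      by (auto intro!: derivative_eq_intros)
    moreover have "((deriv ^^ length is) h has_real_derivative deriv ((deriv ^^ length is) h) (x $ k)) (at (x $ k + 0))"
      using smooth_fun_has_deriv[OF smooth_fun_funpow_deriv[OF assms]] by simp
    ultimately have "((\<lambda>t. (deriv ^^ length is) h (x $ k + t)) has_real_derivative
        deriv ((deriv ^^ length is) h) (x $ k) * 1) (at 0)"
      by (rule DERIV_chain2[rotated])
    with True show ?thesis by (simp add: axis_def)
  next
    case False
    then show ?thesis by (cases "set is \<subseteq> {k}") (simp_all add: axis_def)
  qed
  show eq: "iter_pderiv is (\<lambda>y::real^'n. h (y $ k)) =
     (\<lambda>x. if set is \<subseteq> {k} then (deriv ^^ length is) h (x $ k) else 0)" for "is"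
  proof (induction "is")
    case (Cons i "is")
    show ?case
      unfolding iter_pderiv.simps Cons.IH by (intro ext DERIV_imp_deriv *)
  qed simp
  show "((\<lambda>t. iter_pderiv is (\<lambda>y::real^'n. h (y $ k)) (x + t *\<^sub>R axis i 1)) has_real_derivative
       (if set (i # is) \<subseteq> {k} then (deriv ^^ length (i # is)) h (x $ k) else 0)) (at 0)"
    unfolding eq by (rule *)
qed

lemma smooth_map_diag_map:
  assumes "smooth_fun h"
  shows "smooth_map (diag_map h :: real^'n \<Rightarrow> _)"
proof -
  have comp: "(\<lambda>y::real^'n. diag_map h y $ k) = (\<lambda>y. h (y $ k))" for k
    by (simp add: diag_map_def)
  have "continuous_on UNIV (\<lambda>x::real^'n. (deriv ^^ m) h (x $ k))" for m k
  proof -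
    have "continuous_on UNIV ((deriv ^^ m) h)"
      by (intro continuous_at_imp_continuous_on ballI smooth_fun_isCont smooth_fun_funpow_deriv assms)
    then show ?thesis
      by (rule continuous_on_compose2) (auto intro!: continuous_intros)
  qed
  then have "continuous_on UNIV (iter_pderiv is (\<lambda>y::real^'n. h (y $ k)))" for "is" k
    unfolding iter_pderiv_coordinate(1)[OF assms] by (cases "set is \<subseteq> {k}") simp_all
  moreover have "((\<lambda>t. iter_pderiv is (\<lambda>y::real^'n. h (y $ k)) (x + t *\<^sub>R axis i 1)) has_real_derivative
       iter_pderiv (i # is) (\<lambda>y::real^'n. h (y $ k)) x) (at 0)" for "is" k i x
    using iter_pderiv_coordinate(2)[OF assms, of "is" k x i]
      fun_cong[OF iter_pderiv_coordinate(1)[OF assms, of "i # is" k], of x] by (simp only:)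
  ultimately show ?thesis
    unfolding smooth_map_def comp by blast
qed

lemma continuous_diag_map:
  assumes "h \<in> line_diffeos"
  shows "continuous_on UNIV (diag_map h :: real^'n \<Rightarrow> _)"
proof -
  have "continuous_on UNIV h"
    using assms by (intro continuous_at_imp_continuous_on) (auto simp: line_diffeos_def smooth_fun_isCont)
  then have "continuous_on UNIV (\<lambda>x::real^'n. h (x $ i))" for i
    by (rule continuous_on_compose2) (auto intro!: continuous_intros)
  then show ?thesis
    unfolding diag_map_def[abs_def] by (rule continuous_on_vec_lambda)
qed

lemma diag_map_homeo0:
  assumes "h \<in> line_diffeos"
  shows "diag_map h \<in> homeo0"
  using assms continuous_diag_map[OF assms] continuous_diag_map[OF line_diffeos_inverse[OF assms]]
  by (auto simp: homeo0_def line_diffeos_def diag_map_inverse) (simp add: diag_map_def vec_eq_iff)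

text \<open>Every coordinate has derivative \<open>d\<close> at 0, so the Jacobian is
  \<open>d\<close> times the identity matrix.\<close>

lemma det_jacobian_diag_map:
  assumes "(h has_real_derivative d) (at 0)"
  shows "det (jacobian (diag_map h :: real^'n \<Rightarrow> _) (at 0)) = d ^ CARD('n)"
proof -
  have "(diag_map h has_derivative (\<lambda>v::real^'n. \<chi> i. d * v $ i)) (at 0)"
    unfolding has_derivative_componentwise_within[of "diag_map h"]
  proof
    fix b :: "real^'n" assume "b \<in> Basis"
    then obtain i where b: "b = axis i 1" by (auto simp: Basis_vec_def)
    have "((\<lambda>x::real^'n. x $ i) has_derivative (\<lambda>v. v $ i)) (at 0)"
      by (rule bounded_linear_imp_has_derivative[OF bounded_linear_vec_nth])
    moreover have "(h has_derivative (\<lambda>v. d * v)) (at ((0::real^'n) $ i))"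
      using assms by (simp add: has_field_derivative_def mult_commute_abs)
    ultimately have "((\<lambda>x::real^'n. h (x $ i)) has_derivative (\<lambda>v. d * v $ i)) (at 0)"
      by (rule has_derivative_compose)
    then show "((\<lambda>x. diag_map h x \<bullet> b) has_derivative (\<lambda>v::real^'n. (\<chi> i. d * v $ i) \<bullet> b)) (at 0)"
      by (simp add: b diag_map_def inner_axis)
  qed
  then have "frechet_derivative (diag_map h) (at 0) = (\<lambda>v::real^'n. \<chi> i. d * v $ i)"
    by (metis frechet_derivative_at)
  then have "jacobian (diag_map h :: real^'n \<Rightarrow> _) (at 0) = (\<chi> i j. if i = j then d else 0)"
    by (simp add: jacobian_def matrix_def axis_def vec_eq_iff)
  then show ?thesis by (simp add: det_diagonal)
qed

lemma diag_map_diff_inf0: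
  assumes "h \<in> line_diffeos"
  shows "diag_map h \<in> diff_inf0"
proof -
  have h: "smooth_fun h" "bij h" "h 0 = 0" "deriv h 0 > 0"
    using assms by (auto simp: line_diffeos_def)
  have "smooth_fun (Hilbert_Choice.inv h)"
    using line_diffeos_inverse[OF assms] by (simp add: line_diffeos_def)
  moreover have "diag_map h 0 = 0"
    using h by (simp add: diag_map_def vec_eq_iff)
  ultimately show ?thesis
    using h by (simp add: diff_inf0_def diag_map_inverse smooth_map_diag_map
        det_jacobian_diag_map[OF smooth_fun_has_deriv])
qed

subsection \<open>The group of germs\<close>

lemma germ_eq_iff: "germ f = germ g \<longleftrightarrow> (\<exists>e>0. \<forall>x\<in>ball 0 e. f x = g x)"
proof
  assume "germ f = germ g"
  moreover have "f \<in> germ f" unfolding germ_def by (auto intro: exI[of _ 1])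
  ultimately show "\<exists>e>0. \<forall>x\<in>ball 0 e. f x = g x" by (auto simp: germ_def)
next
  assume "\<exists>e>0. \<forall>x\<in>ball 0 e. f x = g x"
  then obtain e where e: "e > 0" "\<And>x. x \<in> ball 0 e \<Longrightarrow> f x = g x" by blast
  have sub: "germ a \<subseteq> germ b" if "\<And>x. x \<in> ball 0 e \<Longrightarrow> a x = b x" for a b
  proof
    fix c assume "c \<in> germ a"
    then obtain d where "d > 0" "\<forall>x\<in>ball 0 d. c x = a x" by (auto simp: germ_def)
    with that e(1) show "c \<in> germ b"
      unfolding germ_def by (intro CollectI exI[of _ "min d e"]) auto
  qed
  show "germ f = germ g" using sub[of f g] sub[of g f] e(2) by (simp add: subset_antisym)
qed

lemma in_germ_iff: "g \<in> germ f \<longleftrightarrow> germ g = germ f"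
  unfolding germ_eq_iff by (simp add: germ_def)

lemma homeo0_comp: "f \<in> homeo0 \<Longrightarrow> g \<in> homeo0 \<Longrightarrow> f \<circ> g \<in> homeo0"
  unfolding homeo0_def
  by (auto simp: o_inv_distrib bij_comp intro!: continuous_on_compose simp del: o_apply
      intro: continuous_on_subset) simp

lemma homeo0_inverse: "f \<in> homeo0 \<Longrightarrow> Hilbert_Choice.inv f \<in> homeo0"
  unfolding homeo0_def
  by (auto simp: bij_imp_bij_inv inv_inv_eq) (metis bij_inv_eq_iff)

text \<open>Continuity of \<open>g\<close> at its fixed point 0 pulls back the ball on which
  \<open>f'\<close> and \<open>f\<close> agree.\<close>

lemma germ_comp_cong:
  assumes g: "g \<in> homeo0" and "germ f' = germ f" "germ g' = germ g"
  shows "germ (f' \<circ> g') = germ (f \<circ> g)"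
proof -
  obtain e1 where e1: "e1 > 0" "\<And>x. x \<in> ball 0 e1 \<Longrightarrow> f' x = f x"
    using assms(2) by (auto simp: germ_eq_iff)
  obtain e2 where e2: "e2 > 0" "\<And>x. x \<in> ball 0 e2 \<Longrightarrow> g' x = g x"
    using assms(3) by (auto simp: germ_eq_iff)
  have "isCont g 0" "g 0 = 0"
    using g by (auto simp: homeo0_def continuous_on_eq_continuous_at)
  then obtain d where d: "d > 0" "\<And>x. x \<in> ball 0 d \<Longrightarrow> g x \<in> ball 0 e1"
    using e1(1) unfolding continuous_at_eps_delta by (metis dist_commute mem_ball)
  show ?thesis
    unfolding germ_eq_iff
    by (rule exI[of _ "min d e2"]) (use d e1 e2 in auto)
qed

text \<open>The representatives chosen by \<open>SOME\<close> have the given germs, and composition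
  depends only on germs.\<close>

lemma germ_mult_germ:
  assumes "f \<in> homeo0" "g \<in> homeo0"
  shows "germ_mult (germ f) (germ g) = germ (f \<circ> g)"
proof -
  have rep: "germ (SOME f. f \<in> germ h \<inter> homeo0) = germ h"
    if "h \<in> homeo0" for h :: "real^'n \<Rightarrow> real^'n"
  proof -
    have "h \<in> germ h \<inter> homeo0" using that by (simp add: in_germ_iff)
    then have "(SOME f. f \<in> germ h \<inter> homeo0) \<in> germ h \<inter> homeo0" by (rule someI[of "\<lambda>f. f \<in> germ h \<inter> homeo0"])
    then show ?thesis by (simp add: in_germ_iff)
  qed
  show ?thesis
    unfolding germ_mult_def using assms by (intro germ_comp_cong rep)
qed

lemma id_homeo0: "id \<in> homeo0"
  by (simp add: homeo0_def inv_id)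

lemma group_G0: "group (G0 :: (real^'n \<Rightarrow> real^'n) set monoid)"
proof (rule groupI)
  fix x :: "(real^'n \<Rightarrow> real^'n) set" assume "x \<in> carrier G0"
  then obtain f where f: "x = germ f" "f \<in> homeo0" by (auto simp: G0_def)
  then have "Hilbert_Choice.inv f \<circ> f = id" by (simp add: homeo0_def bij_is_inj)
  with f show "\<exists>y\<in>carrier G0. y \<otimes>\<^bsub>G0\<^esub> x = \<one>\<^bsub>G0\<^esub>"
    by (intro bexI[of _ "germ (Hilbert_Choice.inv f)"])
       (auto simp: G0_def germ_mult_germ homeo0_inverse)
qed (auto simp: G0_def germ_mult_germ homeo0_comp id_homeo0 o_assoc)

section \<open>Germs of coordinatewise maps\<close>

lemma diag_germ_mult:
  assumes "f \<in> line_diffeos" "g \<in> line_diffeos"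
  shows "germ (diag_map f) \<otimes>\<^bsub>G0\<^esub> germ (diag_map g) = germ (diag_map (f \<circ> g))"
  using assms by (simp add: G0_def germ_mult_germ diag_map_homeo0 diag_map_comp)

lemma line_diffeos_ident: "(\<lambda>x. x) \<in> line_diffeos"
  using line_diffeos_mult[of 1] by simp

lemma G0_one: "\<one>\<^bsub>G0\<^esub> = germ (diag_map (\<lambda>x. x))"
  by (simp add: G0_def diag_map_id)

text \<open>A generated group stays inside any subgroup containing its generators. This one
  transfers smoothness and torsion-freeness from the line to all of \<open>\<Gamma>\<close>.\<close>

lemma diag_germs_subgroup:
  "subgroup (germ ` diag_map ` line_diffeos) (G0 :: (real^'n \<Rightarrow> real^'n) set monoid)"
proof -
  interpret group "G0 :: (real^'n \<Rightarrow> real^'n) set monoid" by (rule group_G0)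
  have car: "germ (diag_map h) \<in> carrier (G0 :: (real^'n \<Rightarrow> real^'n) set monoid)"
    if "h \<in> line_diffeos" for h
    using that by (simp add: G0_def diag_map_homeo0)
  show ?thesis
  proof (rule subgroupI)
    fix x :: "(real^'n \<Rightarrow> real^'n) set"
    assume "x \<in> germ ` diag_map ` line_diffeos"
    then obtain h where h: "x = germ (diag_map h)" "h \<in> line_diffeos" by auto
    define g where "g = Hilbert_Choice.inv h"
    have g: "g \<in> line_diffeos" unfolding g_def by (rule line_diffeos_inverse[OF h(2)])
    have "g \<circ> h = (\<lambda>x. x)"
      using h by (auto simp: g_def line_diffeos_def bij_is_inj)
    then have "germ (diag_map g) \<otimes>\<^bsub>G0\<^esub> x = \<one>\<^bsub>G0\<^esub>"
      using h g by (simp add: diag_germ_mult G0_one)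
    then have "inv\<^bsub>G0\<^esub> x = germ (diag_map g)"
      by (rule inv_equality) (use car h g in auto)
    then show "inv\<^bsub>G0\<^esub> x \<in> germ ` diag_map ` line_diffeos" using g by blast
  next
    fix x y :: "(real^'n \<Rightarrow> real^'n) set"
    assume "x \<in> germ ` diag_map ` line_diffeos" "y \<in> germ ` diag_map ` line_diffeos"
    then obtain f g where "f \<in> line_diffeos" "g \<in> line_diffeos" "x = germ (diag_map f)" "y = germ (diag_map g)"
      by auto
    then show "x \<otimes>\<^bsub>G0\<^esub> y \<in> germ ` diag_map ` line_diffeos"
      using line_diffeos_comp[of f g] by (simp add: diag_germ_mult)
  qed (use car line_diffeos_ident in auto)
qed

lemma diag_germ_pow:
  assumes "h \<in> line_diffeos"
  shows "germ (diag_map h :: real^'n \<Rightarrow> _) [^]\<^bsub>G0\<^esub> (m::nat) = germ (diag_map (h ^^ m))"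
proof (induction m)
  case 0
  show ?case by (simp add: G0_one id_def nat_pow_def)
next
  case (Suc m)
  have "germ (diag_map h :: real^'n \<Rightarrow> _) [^]\<^bsub>G0\<^esub> Suc m = germ (diag_map (h ^^ m)) \<otimes>\<^bsub>G0\<^esub> germ (diag_map h)"
    using Suc by (simp add: nat_pow_def)
  also have "\<dots> = germ (diag_map (h ^^ m \<circ> h))"
    using assms by (intro diag_germ_mult line_diffeos_funpow)
  finally show ?case by (simp only: funpow_Suc_right)
qed

lemma vec_mem_ball:
  assumes "\<bar>y\<bar> < e / CARD('n)"
  shows "(vec y :: real^'n) \<in> ball 0 e"
proof -
  have "norm (vec y :: real^'n) \<le> CARD('n) * \<bar>y\<bar>"
    using norm_le_l1_cart[of "vec y :: real^'n"] by simp
  also have "\<dots> < e"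
    using assms by (simp add: field_simps)
  finally show ?thesis by simp
qed

text \<open>Testing on diagonal vectors gives one direction; each coordinate being bounded by the
  norm gives the other.\<close>

lemma diag_germ_eq_iff:
  "germ (diag_map f :: real^'n \<Rightarrow> _) = germ (diag_map g) \<longleftrightarrow> (\<exists>d>0. \<forall>y. \<bar>y\<bar> < d \<longrightarrow> f y = g y)"
proof
  assume "germ (diag_map f :: real^'n \<Rightarrow> _) = germ (diag_map g)"
  then obtain e where e: "e > 0" "\<And>x::real^'n. x \<in> ball 0 e \<Longrightarrow> diag_map f x = diag_map g x"
    by (auto simp: germ_eq_iff)
  have "f y = g y" if "\<bar>y\<bar> < e / CARD('n)" for y
    using e(2)[OF vec_mem_ball[OF that]] by (simp add: diag_map_vec vec_eq_iff)
  with e(1) show "\<exists>d>0. \<forall>y. \<bar>y\<bar> < d \<longrightarrow> f y = g y"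
    by (intro exI[of _ "e / CARD('n)"]) auto
next
  assume "\<exists>d>0. \<forall>y. \<bar>y\<bar> < d \<longrightarrow> f y = g y"
  then obtain d where d: "d > 0" "\<And>y. \<bar>y\<bar> < d \<Longrightarrow> f y = g y" by blast
  show "germ (diag_map f :: real^'n \<Rightarrow> _) = germ (diag_map g)"
    unfolding germ_eq_iff
  proof (intro exI[of _ d] conjI ballI d(1))
    fix x :: "real^'n" assume "x \<in> ball 0 d"
    then have "\<bar>x $ i\<bar> < d" for i using component_le_norm_cart[of x i] by simp
    then show "diag_map f x = diag_map g x" by (simp add: diag_map_def d(2))
  qed
qed

lemma diag_germ_torsion_free:
  assumes "h \<in> line_diffeos" "m > 0"
    and "germ (diag_map h :: real^'n \<Rightarrow> _) [^]\<^bsub>G0\<^esub> (m::nat) = \<one>\<^bsub>G0\<^esub>"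
  shows "germ (diag_map h :: real^'n \<Rightarrow> _) = \<one>\<^bsub>G0\<^esub>"
  using assms line_diffeos_funpow_fixed[OF assms(1,2)]
  unfolding diag_germ_pow[OF assms(1)] G0_one diag_germ_eq_iff by blast

subsection \<open>Non-realizability\<close>

context sparse_diffeo
begin

lemma rescaled_Suc: "(\<lambda>x. 1 / 2 * x) \<circ> (rescaled k \<circ> (\<lambda>x. 2 * x)) = rescaled (Suc k)"
  by (auto simp: rescaled_def mult_ac)

text \<open>A relation between germs in \<open>\<Gamma>\<close> becomes an identity of maps on the
  whole space. The generators follow their formulas on one fixed ball, and for large
  \<open>j\<close> the point where the formulas fail to commute lies in it.\<close>

lemma not_realizable:
  fixes \<Gamma> :: "(real^'n \<Rightarrow> real^'n) set set"
  assumes \<Gamma>: "subgroup \<Gamma> G0"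
    and mem: "germ (diag_map s) \<in> \<Gamma>" "germ (diag_map (\<lambda>x. 1 / 2 * x)) \<in> \<Gamma>" "germ (diag_map (\<lambda>x. 2 * x)) \<in> \<Gamma>"
    and \<phi>: "\<phi> \<in> hom (G0\<lparr>carrier := \<Gamma>\<rparr>) Homeo_grp"
    and germ: "\<And>\<gamma>. \<gamma> \<in> \<Gamma> \<Longrightarrow> germ (\<phi> \<gamma>) = \<gamma>"
  shows False
proof -
  define S where "S = \<phi> (germ (diag_map s))"
  define T where "T = \<phi> (germ (diag_map (\<lambda>x. 1 / 2 * x)))"
  define U where "U = \<phi> (germ (diag_map (\<lambda>x. 2 * x)))"
  define R where "R k = \<phi> (germ (diag_map (rescaled k)))" for k
  have near: "\<exists>d>0. \<forall>y. \<bar>y\<bar> < d \<longrightarrow> \<phi> (germ (diag_map h)) (vec y) = vec (h y)"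
    if h: "germ (diag_map h) \<in> \<Gamma>" for h
  proof -
    obtain e where e: "e > 0" "\<And>x. x \<in> ball 0 e \<Longrightarrow> \<phi> (germ (diag_map h)) x = diag_map h x"
      using germ[OF h] by (auto simp: germ_eq_iff)
    then show ?thesis
      using vec_mem_ball[of _ e, where 'n = 'n]
      by (intro exI[of _ "e / CARD('n)"]) (auto simp: diag_map_vec)
  qed
  obtain dS where dS: "dS > 0" "\<And>y. \<bar>y\<bar> < dS \<Longrightarrow> S (vec y) = vec (s y)"
    using near[OF mem(1)] unfolding S_def by blast
  obtain dT where dT: "dT > 0" "\<And>y. \<bar>y\<bar> < dT \<Longrightarrow> T (vec y) = vec (1 / 2 * y)"
    using near[OF mem(2)] unfolding T_def by blast
  obtain dU where dU: "dU > 0" "\<And>y. \<bar>y\<bar> < dU \<Longrightarrow> U (vec y) = vec (2 * y)"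
    using near[OF mem(3)] unfolding U_def by blast
  \<comment> \<open>This radius depends only on the three realized generators and is fixed before
    \<open>k\<close> and \<open>j\<close>.\<close>
  define d where "d = min dS (min dT dU)"
  have d: "d > 0" "\<And>y. \<bar>y\<bar> < d \<Longrightarrow> S (vec y) = vec (s y)"
      "\<And>y. \<bar>y\<bar> < d \<Longrightarrow> T (vec y) = vec (1 / 2 * y)" "\<And>y. \<bar>y\<bar> < d \<Longrightarrow> U (vec y) = vec (2 * y)"
    using dS dT dU by (auto simp: d_def)
  have \<phi>_mult: "\<phi> (\<gamma> \<otimes>\<^bsub>G0\<^esub> \<gamma>') = \<phi> \<gamma> \<circ> \<phi> \<gamma>'" if "\<gamma> \<in> \<Gamma>" "\<gamma>' \<in> \<Gamma>" for \<gamma> \<gamma>'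
    using \<phi> that by (auto simp: hom_def Homeo_grp_def)
  have closed: "\<gamma> \<otimes>\<^bsub>G0\<^esub> \<gamma>' \<in> \<Gamma>" if "\<gamma> \<in> \<Gamma>" "\<gamma>' \<in> \<Gamma>" for \<gamma> \<gamma>'
    using \<Gamma> that by (rule subgroup.m_closed)
  have half: "(\<lambda>x. 1 / 2 * x) \<in> line_diffeos" and twice: "(\<lambda>x. 2 * x) \<in> line_diffeos"
    by (rule line_diffeos_mult; simp)+
  have conj: "germ (diag_map (rescaled (Suc k))) = germ (diag_map (\<lambda>x. 1 / 2 * x)) \<otimes>\<^bsub>G0\<^esub>
      (germ (diag_map (rescaled k)) \<otimes>\<^bsub>G0\<^esub> germ (diag_map (\<lambda>x::real. 2 * x)))" for k
    by (simp only: diag_germ_mult half twice rescaled_diffeo line_diffeos_comp rescaled_Suc)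
  have rescaled_0: "rescaled 0 = s" by (auto simp: rescaled_def)
  have memR: "germ (diag_map (rescaled k)) \<in> \<Gamma>" for k
    by (induction k) (use mem closed in \<open>simp_all only: conj rescaled_0\<close>)
  have R_Suc: "R (Suc k) = T \<circ> (R k \<circ> U)" for k
    unfolding R_def T_def U_def conj using mem memR closed by (simp only: \<phi>_mult)
  text \<open>The same \<open>d\<close> serves for all \<open>k\<close>, whereas the germ of \<open>R k\<close> alone gives no uniform radius.\<close>
  have R: "R k (vec y) = vec (rescaled k y)" if "\<bar>2 ^ k * y\<bar> < d" "\<bar>s (2 ^ k * y)\<bar> < d" for k y
    using that
  proof (induction k arbitrary: y)
    case 0
    then show ?case using d(2) by (simp add: R_def S_def rescaled_0)
  next
    case (Suc k)
    have "1 * \<bar>y\<bar> \<le> 2 ^ Suc k * \<bar>y\<bar>"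
      by (intro mult_right_mono one_le_power) auto
    then have "\<bar>y\<bar> < d" using Suc.prems(1) by (simp add: abs_mult)
    then have "R (Suc k) (vec y) = T (R k (vec (2 * y)))"
      by (simp add: R_Suc d(4))
    also have "\<dots> = T (vec (rescaled k (2 * y)))"
      using Suc by (simp add: mult_ac)
    \<comment> \<open>Halving only shrinks the image under \<open>s\<close>, so the bounds at the
      outermost point control all intermediate ones.\<close>
    also have "\<bar>rescaled k (2 * y)\<bar> < d"
    proof -
      have "\<bar>rescaled k (2 * y)\<bar> = \<bar>s (2 ^ Suc k * y)\<bar> / 2 ^ k"
        by (simp add: rescaled_def mult_ac)
      also have "\<dots> \<le> \<bar>s (2 ^ Suc k * y)\<bar> / 1"
        by (intro divide_left_mono) auto
      finally show ?thesis using Suc.prems(2) by simp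
    qed
    then have "T (vec (rescaled k (2 * y))) = vec (1 / 2 * rescaled k (2 * y))"
      by (rule d(3))
    also have "1 / 2 * rescaled k (2 * y) = rescaled (Suc k) y"
      using fun_cong[OF rescaled_Suc[of k], of y] by simp
    finally show ?case .
  qed
  \<comment> \<open>Commutation near 0, on a ball that may shrink with \<open>k\<close>, is turned
    by the homomorphism into commutation everywhere.\<close>
  have comm: "R k \<circ> S = S \<circ> R k" if "k > 0" for k
  proof -
    have "germ (diag_map (rescaled k \<circ> s) :: real^'n \<Rightarrow> _) = germ (diag_map (s \<circ> rescaled k))"
      unfolding diag_germ_eq_iff using rescaled_commutes_near_0[OF that] by simp
    then have "germ (diag_map (rescaled k) :: real^'n \<Rightarrow> _) \<otimes>\<^bsub>G0\<^esub> germ (diag_map s) =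
        germ (diag_map s) \<otimes>\<^bsub>G0\<^esub> germ (diag_map (rescaled k))"
      by (simp add: diag_germ_mult diffeo rescaled_diffeo)
    then show ?thesis
      unfolding R_def S_def using \<phi>_mult[OF mem(1) memR[of k]] \<phi>_mult[OF memR[of k] mem(1)] by simp
  qed
  obtain j where j: "2 / d < 2 ^ j"
    using real_arch_pow[of 2 "2 / d"] by auto
  have "2 / d < shell_scale j" using j shell_scale_ge[of j] by simp
  then have small: "2 / shell_scale j < d"
    using d(1) shell_scale_pos[of j] by (simp add: field_simps)
  define k where "k = 2 * j + 2"
  obtain u where u: "0 < u" "s (2 ^ k * u) = 2 ^ k * u" "s (2 ^ k * s u) \<noteq> 2 ^ k * s u" "u \<le> s u"
      "2 ^ k * u \<le> 2 / shell_scale j" "2 ^ k * s u \<le> 2 / shell_scale j"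
      "s (2 ^ k * s u) \<le> 2 / shell_scale j"
    using rescaled_not_commute[of j] unfolding k_def by blast
  have "0 < s u" using u by simp
  then have pos: "0 < 2 ^ k * u" "0 < 2 ^ k * s u" using u by simp_all
  then have pos': "0 < s (2 ^ k * s u)" using moves_right[of "2 ^ k * s u"] by simp
  have "1 * u \<le> 2 ^ k * u" using u(1) by (intro mult_right_mono one_le_power) auto
  then have "\<bar>u\<bar> < d" using u small by linarith
  then have Su: "S (vec u) = vec (s u)" by (rule d(2))
  have "R k (vec u) = vec (rescaled k u)"
    by (rule R) (use u pos small in auto)
  also have "rescaled k u = u" using u by (simp add: rescaled_def)
  finally have Ru: "R k (vec u) = vec u" .
  have "R k (vec (s u)) = vec (rescaled k (s u))"
    by (rule R) (use u pos pos' small in auto)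
  \<comment> \<open>Evaluating the commutation at \<open>vec u\<close>, which \<open>R k\<close>
    fixes, shows that \<open>R k\<close> also fixes its image under \<open>S\<close>, contrary to
    the choice of \<open>u\<close>.\<close>
  then have "vec (rescaled k (s u)) = (vec (s u) :: real^'n)"
    using fun_cong[OF comm[of k], of "vec u"] Su Ru by (simp add: k_def)
  then have "rescaled k (s u) = s u" by (simp add: vec_eq_iff)
  then show False using u(3) by (simp add: rescaled_def field_simps)
qed

end

theorem theorem3p1:
  shows "\<exists>\<Gamma> :: (real^'n::finite \<Rightarrow> real^'n) set set.
     subgroup \<Gamma> G0 \<and>
     (\<exists>S. finite S \<and> S \<subseteq> \<Gamma> \<and> generate G0 S = \<Gamma>) \<and>
     (\<forall>\<gamma>\<in>\<Gamma>. \<forall>m::nat. m > 0 \<longrightarrow> \<gamma> [^]\<^bsub>G0\<^esub> m = \<one>\<^bsub>G0\<^esub> \<longrightarrow> \<gamma> = \<one>\<^bsub>G0\<^esub>) \<and>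
     \<Gamma> \<subseteq> germ ` diff_inf0 \<and>
     \<not> (\<exists>\<phi>. \<phi> \<in> hom (G0\<lparr>carrier := \<Gamma>\<rparr>) Homeo_grp \<and> (\<forall>\<gamma>\<in>\<Gamma>. germ (\<phi> \<gamma>) = \<gamma>))"
proof -
  interpret group "G0 :: (real^'n \<Rightarrow> real^'n) set monoid" by (rule group_G0)
  obtain s where "sparse_diffeo s"
    using sparse_diffeo_exists by (auto simp: sparse_diffeo_def)
  then interpret sparse_diffeo s .
  \<comment> \<open>Doubling, the inverse of halving, is listed so that the germs on both sides of
    the conjugation are visibly in \<open>\<Gamma>\<close>.\<close>
  define S :: "(real^'n \<Rightarrow> real^'n) set set" where
    "S = germ ` diag_map ` {s, \<lambda>x. 1 / 2 * x, \<lambda>x. 2 * x}"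
  define \<Gamma> where "\<Gamma> = generate G0 S"
  have "(\<lambda>x. 1 / 2 * x) \<in> line_diffeos" "(\<lambda>x. 2 * x) \<in> line_diffeos"
    by (rule line_diffeos_mult; simp)+
  then have S: "S \<subseteq> germ ` diag_map ` line_diffeos"
    unfolding S_def using diffeo by (intro image_mono insert_subsetI empty_subsetI)
  have \<Gamma>_diag: "\<Gamma> \<subseteq> germ ` diag_map ` line_diffeos"
    unfolding \<Gamma>_def by (rule generate_subgroup_incl[OF S diag_germs_subgroup])
  have "S \<subseteq> carrier G0"
    using S subgroup.subset[OF diag_germs_subgroup] by blast
  then have sub: "subgroup \<Gamma> G0"
    unfolding \<Gamma>_def by (rule generate_is_subgroup)
  have S\<Gamma>: "S \<subseteq> \<Gamma>"
    unfolding \<Gamma>_def by (rule subsetI) (rule generate.incl)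
  have "germ (diag_map s) \<in> \<Gamma>" "germ (diag_map (\<lambda>x. 1 / 2 * x)) \<in> \<Gamma>" "germ (diag_map (\<lambda>x. 2 * x)) \<in> \<Gamma>"
    by (rule subsetD[OF S\<Gamma>], simp only: S_def image_insert insert_iff simp_thms)+
  then have not_realized: "\<not> (\<exists>\<phi>. \<phi> \<in> hom (G0\<lparr>carrier := \<Gamma>\<rparr>) Homeo_grp \<and> (\<forall>\<gamma>\<in>\<Gamma>. germ (\<phi> \<gamma>) = \<gamma>))"
    using not_realizable[OF sub] by (metis (no_types, lifting))
  have smooth: "\<Gamma> \<subseteq> germ ` diff_inf0"
    using \<Gamma>_diag diag_map_diff_inf0 by blast
  have torsion_free: "\<gamma> = \<one>\<^bsub>G0\<^esub>" if "\<gamma> \<in> \<Gamma>" "m > 0" "\<gamma> [^]\<^bsub>G0\<^esub> m = \<one>\<^bsub>G0\<^esub>" for \<gamma> and m :: nat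
  proof -
    obtain h where "h \<in> line_diffeos" "\<gamma> = germ (diag_map h)"
      using \<open>\<gamma> \<in> \<Gamma>\<close> \<Gamma>_diag by blast
    with that diag_germ_torsion_free show ?thesis by simp
  qed
  have "finite S" by (simp add: S_def)
  then have fin_gen: "\<exists>S. finite S \<and> S \<subseteq> \<Gamma> \<and> generate G0 S = \<Gamma>"
    using S\<Gamma> \<Gamma>_def by metis
  show ?thesis
    by (rule exI[of _ \<Gamma>], intro conjI ballI allI impI)
       (fact sub fin_gen smooth not_realized | erule (2) torsion_free)+
qed

end
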